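(* Let $n\ge 3$ and let $W_n = K_1\vee C_n$ be the wheel graph. Then $l_{\max}(W_n) = l(-W_n) = \lceil \frac{n}{2}\rceil$. Additionally, when $n$ is odd, the switching class of $-W_n$ is the unique switching class that maximises the frustration index of $W_n$. When $n$ is even, a signed graph $(W_n,\sigma)$ maximises the frustration index (i.e. $l(W_n,\sigma)=l_{\max}(W_n)$) if and only if it contains $\frac{n}{2}$ pairwise edge-disjoint negative triangles.
   Context: All graphs are finite, simple and undirected. A signed graph $\Sigma=(G,\sigma)$ is a graph $G$ with a signature $\sigma:E(G)\to\{+1,-1\}$. The sign of a cycle is the product of the signs of its edges; $\Sigma$ is balanced if all its cycles are positive. The frustration index $l(\Sigma)$ is the minimum number of edges whose deletion makes $\Sigma$ balanced; it is invariant under switching. $-G$ is $G$ with all edges signed $-1$. $l_{\max}(G)=\max_\sigma l(G,\sigma)$. Switching $\Sigma$ at a vertex subset $X$ negates the signs of all edges with exactly one endpoint in $X$; a switching class is an equivalence class of signatures of $G$ under switching. $C_n$ is the cycle on $n$ vertices and $\vee$ denotes the join of vertex-disjoint graphs. *)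

theory Defs
  imports Complex_Main "HOL-Library.FuncSet"
begin

record 'a graph =
  verts :: "'a set"
  edges :: "'a set set"

definition simple_graph :: "'a graph \<Rightarrow> bool" where
  "simple_graph G \<longleftrightarrow> finite (verts G) \<and> edges G \<subseteq> {e. e \<subseteq> verts G \<and> card e = 2}"

definition delete_edges :: "'a graph \<Rightarrow> 'a set set \<Rightarrow> 'a graph" where
  "delete_edges G F = G\<lparr>edges := edges G - F\<rparr>"

definition cycle_edges :: "'a list \<Rightarrow> 'a set set" where
  "cycle_edges vs = {{vs ! i, vs ! (Suc i mod length vs)} | i. i < length vs}"

text \<open>A cycle of a graph is identified with its edge set.\<close>

definition cycles :: "'a graph \<Rightarrow> 'a set set set" where
  "cycles G = {cycle_edges vs | vs. 3 \<le> length vs \<and> distinct vs \<and>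
                 set vs \<subseteq> verts G \<and> cycle_edges vs \<subseteq> edges G}"

definition triangles :: "'a graph \<Rightarrow> 'a set set set" where
  "triangles G = {C \<in> cycles G. card C = 3}"

definition complete_graph :: "'a set \<Rightarrow> 'a graph" where
  "complete_graph V = \<lparr>verts = V, edges = {e. e \<subseteq> V \<and> card e = 2}\<rparr>"

definition cycle_graph :: "nat \<Rightarrow> nat graph" where
  "cycle_graph n = \<lparr>verts = {0..<n}, edges = cycle_edges [0..<n]\<rparr>"

text \<open>The join; only meant for graphs with disjoint vertex sets.\<close>

definition join :: "'a graph \<Rightarrow> 'a graph \<Rightarrow> 'a graph" where
  "join G H = \<lparr>verts = verts G \<union> verts H,
     edges = edges G \<union> edges H \<union> {{u, v} | u v. u \<in> verts G \<and> v \<in> verts H}\<rparr>"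

text \<open>The rim has vertices \<open>0, \<dots>, n - 1\<close>; the hub is the vertex \<open>n\<close>.\<close>

definition wheel :: "nat \<Rightarrow> nat graph" where
  "wheel n = join (complete_graph {n}) (cycle_graph n)"

text \<open>Signatures are extensional functions on the edge set, so that two signatures are
  equal iff they agree on all edges.\<close>

definition signatures :: "'a graph \<Rightarrow> ('a set \<Rightarrow> int) set" where
  "signatures G = edges G \<rightarrow>\<^sub>E {1, - 1}"

definition sign :: "('a set \<Rightarrow> int) \<Rightarrow> 'a set set \<Rightarrow> int" where
  "sign \<sigma> C = (\<Prod>e\<in>C. \<sigma> e)"

definition balanced :: "'a graph \<Rightarrow> ('a set \<Rightarrow> int) \<Rightarrow> bool" where
  "balanced G \<sigma> \<longleftrightarrow> (\<forall>C\<in>cycles G. sign \<sigma> C = 1)"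

definition frustration_index :: "'a graph \<Rightarrow> ('a set \<Rightarrow> int) \<Rightarrow> nat" where
  "frustration_index G \<sigma> =
     Min (card ` {F. F \<subseteq> edges G \<and> balanced (delete_edges G F) (restrict \<sigma> (edges G - F))})"

definition max_frustration_index :: "'a graph \<Rightarrow> nat" where
  "max_frustration_index G = Max (frustration_index G ` signatures G)"

definition all_negative :: "'a graph \<Rightarrow> 'a set \<Rightarrow> int" where
  "all_negative G = (\<lambda>e\<in>edges G. - 1)"

text \<open>An edge has exactly one endpoint in \<open>X\<close> iff it meets \<open>X\<close> in one vertex.\<close>

definition switch :: "'a graph \<Rightarrow> 'a set \<Rightarrow> ('a set \<Rightarrow> int) \<Rightarrow> 'a set \<Rightarrow> int" where
  "switch G X \<sigma> = (\<lambda>e\<in>edges G. if card (e \<inter> X) = 1 then - \<sigma> e else \<sigma> e)"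

definition switching_rel :: "'a graph \<Rightarrow> (('a set \<Rightarrow> int) \<times> ('a set \<Rightarrow> int)) set" where
  "switching_rel G = {(\<sigma>, \<tau>). \<sigma> \<in> signatures G \<and> (\<exists>X\<subseteq>verts G. \<tau> = switch G X \<sigma>)}"

definition switching_classes :: "'a graph \<Rightarrow> ('a set \<Rightarrow> int) set set" where
  "switching_classes G = signatures G // switching_rel G"

text \<open>The frustration index is invariant under switching, so a switching class is maximising
  iff its members share the single value \<open>max_frustration_index G\<close>.\<close>

definition maximising_class :: "'a graph \<Rightarrow> ('a set \<Rightarrow> int) set \<Rightarrow> bool" where
  "maximising_class G K \<longleftrightarrow>
     K \<in> switching_classes G \<and> frustration_index G ` K = {max_frustration_index G}"

lemma switch_in_signatures:
  "\<sigma> \<in> signatures G \<Longrightarrow> switch G X \<sigma> \<in> signatures G"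
  unfolding signatures_def switch_def by (auto simp: PiE_iff)

lemma card_edge_Int_eq_1:
  "u \<noteq> v \<Longrightarrow> card ({u, v} \<inter> X) = 1 \<longleftrightarrow> (u \<in> X) \<noteq> (v \<in> X)"
  by (cases "u \<in> X"; cases "v \<in> X") auto

lemma switch_switch:
  assumes "simple_graph G"
  shows "switch G Y (switch G X \<sigma>) = switch G ((X - Y) \<union> (Y - X)) \<sigma>"
proof (rule ext)
  fix e
  show "switch G Y (switch G X \<sigma>) e = switch G ((X - Y) \<union> (Y - X)) \<sigma> e"
  proof (cases "e \<in> edges G")
    case True
    then have "card e = 2" using assms by (auto simp: simple_graph_def)
    then obtain u v where e: "e = {u, v}" "u \<noteq> v" by (auto simp: card_2_iff)
    show ?thesis
      using True by (simp add: switch_def e(1) card_edge_Int_eq_1[OF e(2), simplified]) auto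
  qed (simp add: switch_def)
qed

lemma equiv_switching_rel:
  assumes "simple_graph G"
  shows "equiv (signatures G) (switching_rel G)"
proof (rule equivI)
  have triv: "switch G {} \<sigma> = \<sigma>" if "\<sigma> \<in> signatures G" for \<sigma>
    using that by (auto simp: switch_def signatures_def PiE_iff extensional_def)
  show "switching_rel G \<subseteq> signatures G \<times> signatures G"
    by (auto simp: switching_rel_def switch_in_signatures)
  show "refl_on (signatures G) (switching_rel G)"
    by (rule refl_onI) (force simp: switching_rel_def triv)
  show "sym (switching_rel G)"
  proof (rule symI)
    fix \<sigma> \<tau> assume "(\<sigma>, \<tau>) \<in> switching_rel G"
    then obtain X where X: "\<sigma> \<in> signatures G" "X \<subseteq> verts G" "\<tau> = switch G X \<sigma>"
      by (auto simp: switching_rel_def)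
    then have "\<sigma> = switch G X \<tau>" by (simp add: switch_switch[OF assms] triv)
    moreover have "\<tau> \<in> signatures G" using X switch_in_signatures by blast
    ultimately show "(\<tau>, \<sigma>) \<in> switching_rel G"
      using X(2) unfolding switching_rel_def by blast
  qed
  show "trans (switching_rel G)"
  proof (rule transI)
    fix \<sigma> \<tau> \<rho> assume "(\<sigma>, \<tau>) \<in> switching_rel G" "(\<tau>, \<rho>) \<in> switching_rel G"
    then obtain X Y where XY: "\<sigma> \<in> signatures G" "X \<subseteq> verts G" "Y \<subseteq> verts G"
      "\<rho> = switch G Y (switch G X \<sigma>)" unfolding switching_rel_def by blast
    have "(X - Y) \<union> (Y - X) \<subseteq> verts G" using XY by blast
    with XY show "(\<sigma>, \<rho>) \<in> switching_rel G"
      unfolding switching_rel_def switch_switch[OF assms] by blast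
  qed
qed

lemma simple_graph_wheel:
  assumes "3 \<le> n"
  shows "simple_graph (wheel n)"
proof -
  have "i \<noteq> Suc i mod n" if "i < n" for i
    using assms that by (cases "Suc i = n") auto
  then have "card {i, Suc i mod n} = 2" if "i < n" for i
    using that by simp
  moreover have "card {n, i} = 2" if "i < n" for i
    using that by simp
  moreover have "Suc i mod n < n" for i
    using assms by simp
  ultimately show ?thesis
    using assms
    by (auto simp: simple_graph_def wheel_def join_def complete_graph_def cycle_graph_def
        cycle_edges_def less_imp_le)
qed

end

theory Submission
  imports Defs
begin

text \<open>
  Number the rim triangles of the wheel cyclically and let \<open>e i\<close> say that triangle \<open>i\<close> is negative.
  Every edge lies in at most two rim triangles, and every set whose deletion balances the graph meets
  every negative triangle; this gives the lower bounds.

  For the upper bounds, any 0-1 vector \<open>x\<close> on the rim vertices yields a balancing set: delete the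
  spokes with \<open>x i\<close> and the rim edges \<open>i\<close> at which \<open>x i \<noteq> x (i + 1)\<close> disagrees with \<open>e i\<close>. Choosing
  \<open>x\<close> with at most one disagreement and comparing it with its complement costs about \<open>n / 2\<close>.
  A positive triangle leaves room to improve: rotate it to position 0, so that \<open>x 0 = x 1 = 1\<close>, and
  flip these two entries. For even \<open>n\<close> with positive triangles of both parities, take two
  of them, at 0 and \<open>d\<close>, at minimal odd distance. Then \<open>x\<close> reads \<open>1, 1, 0, 1, \<dots>, 0, 1, 1\<close> on
  \<open>0, \<dots>, d + 1\<close>, and flipping this window removes three ones and alters only the two boundary edges.
\<close>

section \<open>0-1 vectors on a cyclic sequence: cost, complement, rotation, prefix flips\<close>

definition ones :: "nat \<Rightarrow> (nat \<Rightarrow> bool) \<Rightarrow> nat" where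
  "ones n x = (\<Sum>i<n. of_bool (x i))"

definition mismatches :: "nat \<Rightarrow> (nat \<Rightarrow> bool) \<Rightarrow> (nat \<Rightarrow> bool) \<Rightarrow> nat set" where
  "mismatches n e x = {i. i < n \<and> ((x i \<noteq> x (Suc i mod n)) \<noteq> e i)}"

definition cost :: "nat \<Rightarrow> (nat \<Rightarrow> bool) \<Rightarrow> (nat \<Rightarrow> bool) \<Rightarrow> nat" where
  "cost n e x = ones n x + card (mismatches n e x)"

lemma ones_complement: "ones n (\<lambda>i. \<not> x i) + ones n x = n"
  by (induction n) (auto simp: ones_def)

text \<open>Mismatches depend only on whether neighbouring entries differ, so complementing keeps
  them and changes only the number of ones. The additive form avoids subtraction of
  naturals.\<close>

lemma cost_complement: "cost n e (\<lambda>i. \<not> x i) + ones n x = n + card (mismatches n e x)"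
proof -
  have "mismatches n e (\<lambda>i. \<not> x i) = mismatches n e x"
    by (auto simp: mismatches_def)
  then show ?thesis
    using ones_complement[of n x] by (simp add: cost_def)
qed

lemma mod_rotate_back:
  fixes i a n :: nat
  assumes "a \<le> n" "i < n"
  shows "((i + a) mod n + (n - a)) mod n = i" "((i + (n - a)) mod n + a) mod n = i"
proof -
  have "((i + a) mod n + (n - a)) mod n = (i + a + (n - a)) mod n"
      "((i + (n - a)) mod n + a) mod n = (i + (n - a) + a) mod n"
    by (rule mod_add_left_eq)+
  moreover have "i + a + (n - a) = i + n" "i + (n - a) + a = i + n"
    using assms by linarith+
  ultimately show "((i + a) mod n + (n - a)) mod n = i" "((i + (n - a)) mod n + a) mod n = i"
    using assms by simp_all
qed

lemma bij_betw_rotate: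
  fixes a n :: nat
  assumes "a < n"
  shows "bij_betw (\<lambda>i. (i + a) mod n) {..<n} {..<n}"
  by (rule bij_betw_byWitness[where f' = "\<lambda>i. (i + (n - a)) mod n"])
    (use assms mod_rotate_back[of a n] in auto)

lemma card_mismatches:
  "card (mismatches n e x) = (\<Sum>i<n. of_bool ((x i \<noteq> x (Suc i mod n)) \<noteq> e i))"
proof -
  have "mismatches n e x = {..<n} \<inter> {i. (x i \<noteq> x (Suc i mod n)) \<noteq> e i}"
    by (auto simp: mismatches_def)
  then show ?thesis by simp
qed

text \<open>Shifting \<open>x\<close> back by \<open>a\<close> undoes the shift of \<open>e\<close>,
  so a chosen positive triangle may be assumed to sit at position 0.\<close>

lemma cost_rotate:
  assumes "a < n"
  shows "cost n e (\<lambda>i. x ((i + (n - a)) mod n)) = cost n (\<lambda>i. e ((i + a) mod n)) x"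
proof -
  let ?y = "\<lambda>i. x ((i + (n - a)) mod n)"
  have y: "?y ((i + a) mod n) = x i" if "i < n" for i
    using mod_rotate_back(1)[of a n i] that assms by simp
  have y': "?y (Suc ((i + a) mod n) mod n) = x (Suc i mod n)" if "i < n" for i
    using y[of "Suc i mod n"] that assms by (simp add: mod_simps)
  have "ones n ?y = ones n x"
    unfolding ones_def
    using sum.reindex_bij_betw[OF bij_betw_rotate[OF assms], of "\<lambda>i. of_bool (?y i) :: nat"] y by simp
  moreover have "card (mismatches n e ?y) = card (mismatches n (\<lambda>i. e ((i + a) mod n)) x)"
    unfolding card_mismatches
    by (subst sum.reindex_bij_betw[OF bij_betw_rotate[OF assms],
          of "\<lambda>i. of_bool ((?y i \<noteq> ?y (Suc i mod n)) \<noteq> e i) :: nat", symmetric],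
        rule sum.cong[OF refl]) (simp only: lessThan_iff y y')
  ultimately show ?thesis by (simp add: cost_def)
qed

text \<open>Solving \<open>x i \<noteq> x (i + 1) \<longleftrightarrow> e i\<close> along the path \<open>0, \<dots>, n - 1\<close> leaves the edge \<open>n - 1\<close> as the only
  possible mismatch.\<close>

primrec path_solution :: "(nat \<Rightarrow> bool) \<Rightarrow> nat \<Rightarrow> bool" where
  "path_solution e 0 = True"
| "path_solution e (Suc i) = (path_solution e i \<noteq> e i)"

lemma mismatches_path_solution: "mismatches n e (path_solution e) \<subseteq> {n - 1}"
proof
  fix i assume i: "i \<in> mismatches n e (path_solution e)"
  then have "\<not> Suc i < n" by (auto simp: mismatches_def)
  with i show "i \<in> {n - 1}" by (auto simp: mismatches_def)
qed

lemma card_mismatches_path_solution: "card (mismatches n e (path_solution e)) \<le> 1"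
  using card_mono[OF _ mismatches_path_solution] by fastforce

text \<open>Only the edges with exactly one end in \<open>0, ..., w\<close> change status: edge
  \<open>w\<close>, leaving the prefix, and edge \<open>n - 1\<close>, returning to 0. The bound on
  \<open>w\<close> makes them distinct.\<close>

lemma mismatches_flip_prefix:
  assumes "w < n - 1"
  shows "mismatches n e (\<lambda>i. (i \<le> w) \<noteq> x i) =
    (mismatches n e x - {w, n - 1}) \<union> ({w, n - 1} - mismatches n e x)"
proof -
  have "i \<in> mismatches n e (\<lambda>i. (i \<le> w) \<noteq> x i) \<longleftrightarrow>
      i \<in> (mismatches n e x - {w, n - 1}) \<union> ({w, n - 1} - mismatches n e x)" for i
  proof (cases "i < n - 1")
    case True
    then have "Suc i mod n = Suc i" by simp
    with True assms show ?thesis unfolding mismatches_def by (cases "i = w") auto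
  next
    case False
    show ?thesis
    proof (cases "i = n - 1")
      case True
      then have "Suc i mod n = 0" using assms by simp
      with True assms show ?thesis unfolding mismatches_def by auto
    next
      case False with \<open>\<not> i < n - 1\<close> assms show ?thesis unfolding mismatches_def by auto
    qed
  qed
  then show ?thesis by blast
qed

text \<open>Here \<open>g\<close> is the surplus of ones over zeros among the first
  \<open>w + 1\<close> entries, which is exactly what a flip of the prefix saves.\<close>

lemma ones_flip_prefix:
  assumes "w < n" "2 * ones (Suc w) x = Suc w + g"
  shows "ones n (\<lambda>i. (i \<le> w) \<noteq> x i) + g = ones n x"
proof -
  have split: "ones n y = ones (Suc w) y + (\<Sum>i=Suc w..<n. of_bool (y i))" for y
    using assms(1) sum.atLeastLessThan_concat[of 0 "Suc w" n "\<lambda>i. of_bool (y i) :: nat"]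
    by (simp add: ones_def lessThan_atLeast0)
  have "ones (Suc w) (\<lambda>i. (i \<le> w) \<noteq> x i) = ones (Suc w) (\<lambda>i. \<not> x i)"
    unfolding ones_def by (rule sum.cong) auto
  moreover have "(\<Sum>i=Suc w..<n. of_bool ((i \<le> w) \<noteq> x i)) = (\<Sum>i=Suc w..<n. of_bool (x i) :: nat)"
    by (rule sum.cong) auto
  ultimately show ?thesis
    using assms(2) ones_complement[of "Suc w" x] split[of x] split[of "\<lambda>i. (i \<le> w) \<noteq> x i"]
    by linarith
qed

text \<open>The flip saves \<open>g\<close> ones. It makes \<open>w\<close> a mismatch and toggles
  \<open>n - 1\<close>, the only possible old one, so \<open>m\<close> mismatches become
  \<open>2 - m\<close>.\<close>

lemma cost_flip_path_solution:
  assumes "w < n - 1" "2 * ones (Suc w) (path_solution e) = Suc w + g"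
  shows "cost n e (\<lambda>i. (i \<le> w) \<noteq> path_solution e i) + g + card (mismatches n e (path_solution e))
    \<le> ones n (path_solution e) + 2"
proof -
  let ?M = "mismatches n e (path_solution e)"
  have "mismatches n e (\<lambda>i. (i \<le> w) \<noteq> path_solution e i) = {w, n - 1} - ?M"
    using mismatches_flip_prefix[OF assms(1)] mismatches_path_solution[of n e] by blast
  moreover have "card ({w, n - 1} - ?M) + card ?M = 2"
  proof -
    have "?M \<subseteq> {w, n - 1}" using mismatches_path_solution by blast
    then have "card ({w, n - 1} - ?M) + card ?M = card {w, n - 1}"
      by (metis card_mono card_Diff_subset finite.emptyI finite.insertI finite_subset le_add_diff_inverse2)
    with assms(1) show ?thesis by simp
  qed
  moreover have "w < n" using assms(1) by simp
  ultimately show ?thesis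
    using ones_flip_prefix[OF _ assms(2)] unfolding cost_def by fastforce
qed

section \<open>Existence of cheap vectors\<close>

lemma exists_cost_le_half:
  assumes "3 \<le> n" "p < n" "\<not> e p"
  shows "\<exists>x. cost n e x \<le> n div 2"
proof -
  define e' where "e' = (\<lambda>i. e ((i + p) mod n))"
  let ?x = "path_solution e'" and ?m = "card (mismatches n e' (path_solution e'))"
  have "\<not> e' 0" using assms by (simp add: e'_def)
  then have "2 * ones (Suc 1) ?x = Suc 1 + 2"
    by (simp add: ones_def)
  from cost_flip_path_solution[OF _ this] assms(1)
  have "cost n e' (\<lambda>i. (i \<le> 1) \<noteq> ?x i) + ?m \<le> ones n ?x" by simp
  moreover have "cost n e' ?x = ones n ?x + ?m" by (simp add: cost_def)
  moreover have "cost n e' (\<lambda>i. \<not> ?x i) + ones n ?x = n + ?m" by (rule cost_complement)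
  moreover have "?m \<le> 1" by (rule card_mismatches_path_solution)
  \<comment> \<open>The flipped vector costs at most \<open>ones n ?x - ?m\<close> and the
    complement costs \<open>n - ones n ?x + ?m\<close>. These sum to at most \<open>n\<close>, so
    one of them is at most half of it.\<close>
  ultimately have "cost n e' (\<lambda>i. (i \<le> 1) \<noteq> ?x i) \<le> n div 2 \<or> cost n e' ?x \<le> n div 2 \<or>
      cost n e' (\<lambda>i. \<not> ?x i) \<le> n div 2"
    by linarith
  then obtain y where "cost n e' y \<le> n div 2" by blast
  then show ?thesis using cost_rotate[OF assms(2), of e y] unfolding e'_def by metis
qed

lemma ones_odd: "ones (2 * t) odd = t"
  by (induction t) (auto simp: ones_def)

text \<open>If every \<open>e i\<close> holds, the alternating vector \<open>odd\<close> is nearly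
  optimal: it fits everywhere for even \<open>n\<close>, and only the closing edge
  \<open>n - 1\<close> can fail for odd \<open>n\<close>.\<close>

lemma exists_cost_le_upper_half:
  assumes "3 \<le> n"
  shows "\<exists>x. cost n e x \<le> (n + 1) div 2"
proof (cases "\<exists>p<n. \<not> e p")
  case True
  then obtain x where "cost n e x \<le> n div 2" using exists_cost_le_half[OF assms] by blast
  then show ?thesis by (intro exI[of _ x]) linarith
next
  case False
  have "cost n e odd \<le> (n + 1) div 2"
  proof (cases "even n")
    case True
    then obtain t where t: "n = 2 * t" by blast
    have "odd (Suc i mod n) \<noteq> odd i" if "i < n" for i
      using that True by (cases "Suc i = n") auto
    then have "mismatches n e odd = {}" using False by (auto simp: mismatches_def)
    then show ?thesis using ones_odd[of t] by (simp add: cost_def t)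
  next
    case odd: False
    then obtain t where t: "n = Suc (2 * t)" by (metis oddE Suc_eq_plus1)
    have "odd (Suc i mod n) \<noteq> odd i" if "i < n" "i \<noteq> n - 1" for i
      using that by auto
    then have "mismatches n e odd \<subseteq> {n - 1}" using False by (auto simp: mismatches_def)
    from card_mono[OF _ this] have "card (mismatches n e odd) \<le> 1" by simp
    moreover have "ones n odd = t" using ones_odd[of t] by (simp add: t ones_def)
    ultimately show ?thesis by (simp add: cost_def t)
  qed
  then show ?thesis by blast
qed

text \<open>Take the least odd forward distance \<open>d\<close> between two positions satisfying
  \<open>P\<close>. As \<open>n\<close> is even, the way back has odd length \<open>n - d\<close>,
  whence \<open>2 * d \<le> n\<close>.\<close>

lemma exists_closest_opposite_parity:
  fixes n a b :: nat
  assumes "even n" "a < n" "b < n" "P a" "P b" "even a" "odd b"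
  shows "\<exists>c d. c < n \<and> odd d \<and> 2 * d \<le> n \<and> P c \<and> P ((c + d) mod n) \<and>
    (\<forall>j. 0 < j \<longrightarrow> j < d \<longrightarrow> \<not> P ((c + j) mod n))"
proof -
  define Q where "Q d \<longleftrightarrow> odd d \<and> (\<exists>c<n. P c \<and> P ((c + d) mod n))" for d
  have "\<exists>d<n. Q d"
  proof (cases "a < b")
    case True
    with assms have "b - a < n" "odd (b - a)" "(a + (b - a)) mod n = b" by auto
    with assms show ?thesis unfolding Q_def by metis
  next
    case False
    with assms have "a > b" by (metis linorder_neqE_nat)
    with assms have "a - b < n" "odd (a - b)" "(b + (a - b)) mod n = a" by auto
    with assms show ?thesis unfolding Q_def by metis
  qed
  then obtain d0 where d0: "d0 < n" "Q d0" by blast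
  define d where "d = (LEAST d. Q d)"
  have "Q d" and least: "\<And>d'. Q d' \<Longrightarrow> d \<le> d'" and "d < n"
    using d0 LeastI[of Q d0] Least_le[of Q] unfolding d_def by (auto intro: le_less_trans)
  then obtain c where c: "odd d" "c < n" "P c" "P ((c + d) mod n)" unfolding Q_def by blast
  have "((c + d) mod n + (n - d)) mod n = c" "odd (n - d)" "(c + d) mod n < n"
    using c assms(1) \<open>d < n\<close> mod_rotate_back(1)[of d n c] by auto
  then have "Q (n - d)" unfolding Q_def using c by metis
  then have "2 * d \<le> n" using least \<open>d < n\<close> by fastforce
  moreover have "\<not> P ((c + j) mod n)" if j: "0 < j" "j < d" for j
  proof
    assume P: "P ((c + j) mod n)"
    \<comment> \<open>A position of \<open>P\<close> strictly inside splits the odd distance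
      \<open>d\<close> into two parts, one of which is odd and shorter than
      \<open>d\<close>.\<close>
    have "Q j \<or> Q (d - j)"
    proof (cases "odd j")
      case True
      with P c show ?thesis unfolding Q_def by blast
    next
      case False
      with c j have "odd (d - j)" by simp
      moreover have "((c + j) mod n + (d - j)) mod n = (c + d) mod n"
        unfolding mod_add_left_eq using j by simp
      moreover have "(c + j) mod n < n" using assms(2) by simp
      ultimately show ?thesis using P c unfolding Q_def by metis
    qed
    with least j show False by fastforce
  qed
  ultimately show ?thesis using c by blast
qed

lemma exists_cost_less_half:
  assumes "4 \<le> n" "even n" "a < n" "b < n" "\<not> e a" "\<not> e b" "even a" "odd b"
  shows "\<exists>x. cost n e x < n div 2"
proof -
  obtain c d where cd: "c < n" "odd d" "2 * d \<le> n" "\<not> e c" "\<not> e ((c + d) mod n)"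
      "\<And>j. 0 < j \<Longrightarrow> j < d \<Longrightarrow> e ((c + j) mod n)"
    using exists_closest_opposite_parity[of n a b "\<lambda>i. \<not> e i"] assms by auto
  define e' where "e' = (\<lambda>i. e ((i + c) mod n))"
  let ?x = "path_solution e'" and ?m = "card (mismatches n e' (path_solution e'))"
  obtain t where t: "d = Suc (2 * t)" using cd(2) by (metis oddE Suc_eq_plus1)
  have e': "\<not> e' 0" "\<not> e' d" "\<And>j. 0 < j \<Longrightarrow> j < d \<Longrightarrow> e' j"
    using cd by (auto simp: e'_def add.commute)
  \<comment> \<open>Edge 0 repeats the initial \<open>True\<close>; after it every edge before
    \<open>d\<close> forces a change.\<close>
  have alt: "?x (Suc j) = even j" if "j < d" for j
    using that by (induction j) (use e' in auto)
  have "ones (Suc (Suc d)) ?x = ones (Suc d) ?x + 1"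
    using alt[of "d - 1"] e'(2) t by (simp add: ones_def)
  \<comment> \<open>The vector agrees with \<open>odd\<close> on \<open>1, ..., d\<close>; the extra
    one is \<open>?x 0\<close>, where \<open>odd\<close> is false.\<close>
  also have "ones (Suc d) ?x = ones (2 * Suc t) odd + 1"
  proof -
    have "ones (Suc d) ?x = Suc (\<Sum>i<d. of_bool (?x (Suc i)))"
      unfolding ones_def sum.lessThan_Suc_shift by simp
    also have "(\<Sum>i<d. of_bool (?x (Suc i))) = (\<Sum>i<d. of_bool (odd (Suc i)) :: nat)"
      by (rule sum.cong[OF refl]) (simp only: alt lessThan_iff even_Suc not_not)
    also have "\<dots> = ones (Suc d) odd"
      unfolding ones_def sum.lessThan_Suc_shift by simp
    finally show ?thesis by (simp add: t)
  qed
  finally have "2 * ones (Suc (d + 1)) ?x = Suc (d + 1) + 3"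
    unfolding ones_odd t by simp
  \<comment> \<open>The window must end before \<open>n - 1\<close>. In the tight case
    \<open>n = 4\<close> the parity of \<open>d\<close> is decisive: it forces
    \<open>d = 1\<close>.\<close>
  moreover have "d + 1 < n - 1" using cd(2,3) assms(1,2) by presburger
  ultimately have "cost n e' (\<lambda>i. (i \<le> d + 1) \<noteq> ?x i) + 3 + ?m \<le> ones n ?x + 2"
    by (intro cost_flip_path_solution)
  moreover have "cost n e' (\<lambda>i. \<not> ?x i) + ones n ?x = n + ?m" by (rule cost_complement)
  moreover have "?m \<le> 1" by (rule card_mismatches_path_solution)
  \<comment> \<open>The two costs now sum to at most \<open>n - 1\<close>; as \<open>n\<close> is
    even, the smaller one is below \<open>n div 2\<close>.\<close>
  ultimately have "cost n e' (\<lambda>i. (i \<le> d + 1) \<noteq> ?x i) < n div 2 \<or>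
      cost n e' (\<lambda>i. \<not> ?x i) < n div 2"
    using assms(2) by presburger
  then obtain y where "cost n e' y < n div 2" by blast
  then show ?thesis using cost_rotate[OF cd(1), of e y] unfolding e'_def by metis
qed


section \<open>Balance and frustration index in arbitrary graphs\<close>

lemma inj_on_cycle_edge:
  assumes "3 \<le> n"
  shows "inj_on (\<lambda>i. {i, Suc i mod n}) {..<n}"
proof (rule inj_onI)
  fix i j assume ij: "i \<in> {..<n}" "j \<in> {..<n}" and eq: "{i, Suc i mod n} = {j, Suc j mod n}"
  \<comment> \<open>Equal edges with distinct indices would make each index the successor of the
    other, so two steps would close up modulo \<open>n\<close>.\<close>
  have "False" if "i = Suc j mod n" "Suc i mod n = j"
  proof -
    have "Suc (Suc j mod n) mod n = j" using that by metis
    then have "(j + 2) mod n = j" by (simp add: mod_Suc_eq)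
    moreover have "(j + 2) mod n = (if j + 2 < n then j + 2 else j + 2 - n)"
      using ij(2) assms by (simp add: mod_if)
    ultimately show False using ij(2) assms by (auto split: if_splits)
  qed
  with eq show "i = j" by (auto simp: doubleton_eq_iff)
qed

text \<open>Allows the product over the edge set of a cycle to be taken over list positions. The
  edges are images of index pairs under the injective \<open>nth\<close>.\<close>

lemma inj_on_list_cycle_edge:
  assumes "3 \<le> length vs" "distinct vs"
  shows "inj_on (\<lambda>i. {vs ! i, vs ! (Suc i mod length vs)}) {..<length vs}"
proof -
  have "inj_on ((`) ((!) vs)) (Pow {..<length vs})"
    using inj_on_nth[OF assms(2)] by (intro inj_on_image_Pow) auto
  then have "inj_on ((`) ((!) vs)) ((\<lambda>i. {i, Suc i mod length vs}) ` {..<length vs})"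
    by (rule inj_on_subset) (use assms in \<open>auto intro!: mod_less_divisor\<close>)
  from comp_inj_on[OF inj_on_cycle_edge[OF assms(1)] this] show ?thesis
    by (simp add: comp_def)
qed

text \<open>The easy half of Harary's balance criterion. Around a cycle every vertex contributes its
  factor \<open>s v\<close> twice, once for each incident cycle edge, and the squares are 1.\<close>

lemma balanced_if_potential:
  assumes edge: "\<And>u v. {u, v} \<in> edges G \<Longrightarrow> u \<noteq> v \<Longrightarrow> \<sigma> {u, v} = s u * s v"
    and square: "\<And>v. v \<in> verts G \<Longrightarrow> s v * s v = 1"
  shows "balanced G \<sigma>"
  unfolding balanced_def
proof
  fix C assume "C \<in> cycles G"
  then obtain vs where vs: "C = cycle_edges vs" "3 \<le> length vs" "distinct vs"
    "set vs \<subseteq> verts G" "cycle_edges vs \<subseteq> edges G"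
    by (auto simp: cycles_def)
  let ?n = "length vs"
  let ?next = "\<lambda>i. Suc i mod ?n"
  have C: "C = (\<lambda>i. {vs ! i, vs ! ?next i}) ` {..<?n}"
    by (auto simp: vs(1) cycle_edges_def)
  have "sign \<sigma> C = (\<Prod>i<?n. \<sigma> {vs ! i, vs ! ?next i})"
    unfolding sign_def C using inj_on_list_cycle_edge[OF vs(2,3)] by (simp add: prod.reindex)
  also have "\<dots> = (\<Prod>i<?n. s (vs ! i) * s (vs ! ?next i))"
  proof (rule prod.cong[OF refl])
    fix i assume i: "i \<in> {..<?n}"
    then have "{vs ! i, vs ! ?next i} \<in> edges G" using vs(1,5) C by blast
    moreover have "i \<noteq> ?next i" using i vs(2) by (cases "Suc i = ?n") auto
    moreover have "?next i < ?n" using vs(2) by (intro mod_less_divisor) linarith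
    ultimately show "\<sigma> {vs ! i, vs ! ?next i} = s (vs ! i) * s (vs ! ?next i)"
      using i vs(3) by (intro edge) (auto simp: nth_eq_iff_index_eq)
  qed
  also have "\<dots> = (\<Prod>i<?n. s (vs ! i)) * (\<Prod>i<?n. s (vs ! ?next i))"
    by (rule prod.distrib)
  also have "(\<Prod>i<?n. s (vs ! ?next i)) = (\<Prod>i<?n. s (vs ! i))"
    using prod.reindex_bij_betw[OF bij_betw_rotate[of 1 ?n], of "\<lambda>i. s (vs ! i)"] vs(2) by simp
  also have "(\<Prod>i<?n. s (vs ! i)) * (\<Prod>i<?n. s (vs ! i)) = (\<Prod>i<?n. s (vs ! i) * s (vs ! i))"
    by (rule prod.distrib[symmetric])
  also have "\<dots> = 1"
    using vs(4) by (intro prod.neutral) (auto intro!: square)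
  finally show "sign \<sigma> C = 1" .
qed

lemma finite_edges: "simple_graph G \<Longrightarrow> finite (edges G)"
  unfolding simple_graph_def using finite_subset[of "edges G" "Pow (verts G)"] by auto

lemma frustration_index_le:
  assumes "simple_graph G" "F \<subseteq> edges G"
    and "balanced (delete_edges G F) (restrict \<sigma> (edges G - F))"
  shows "frustration_index G \<sigma> \<le> card F"
  unfolding frustration_index_def
  using assms finite_edges[OF assms(1)] by (intro Min_le) auto

lemma frustration_index_attained:
  assumes "simple_graph G"
  obtains F where "F \<subseteq> edges G" "balanced (delete_edges G F) (restrict \<sigma> (edges G - F))"
    "frustration_index G \<sigma> = card F"
proof -
  let ?A = "{F. F \<subseteq> edges G \<and> balanced (delete_edges G F) (restrict \<sigma> (edges G - F))}"
  \<comment> \<open>Deleting every edge is admissible, so \<open>Min\<close> ranges over a nonempty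
    set.\<close>
  have "edges G \<in> ?A"
    by (auto intro!: balanced_if_potential[where s = "\<lambda>_. 1"] simp: delete_edges_def)
  moreover have "finite ?A" using finite_edges[OF assms] by simp
  ultimately have "frustration_index G \<sigma> \<in> card ` ?A"
    unfolding frustration_index_def by (intro Min_in) auto
  then show ?thesis using that by blast
qed

text \<open>A cycle avoiding \<open>F\<close> would survive the deletion with its sign
  unchanged.\<close>

lemma negative_cycle_hit:
  assumes "C \<in> cycles G" "sign \<sigma> C \<noteq> 1"
    and "balanced (delete_edges G F) (restrict \<sigma> (edges G - F))"
  shows "C \<inter> F \<noteq> {}"
proof
  assume disj: "C \<inter> F = {}"
  have "C \<subseteq> edges G" using assms(1) by (auto simp: cycles_def)
  with disj have "C \<in> cycles (delete_edges G F)"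
    using assms(1) by (auto simp: cycles_def delete_edges_def)
  moreover have "sign (restrict \<sigma> (edges G - F)) C = sign \<sigma> C"
    unfolding sign_def using \<open>C \<subseteq> edges G\<close> disj by (intro prod.cong) auto
  ultimately show False using assms(2,3) by (auto simp: balanced_def)
qed

section \<open>Edges and rim triangles of the wheel\<close>

definition spoke :: "nat \<Rightarrow> nat \<Rightarrow> nat set" where
  "spoke n i = {n, i}"

definition rim :: "nat \<Rightarrow> nat \<Rightarrow> nat set" where
  "rim n i = {i, Suc i mod n}"

definition triangle :: "nat \<Rightarrow> nat \<Rightarrow> nat set set" where
  "triangle n i = {spoke n i, spoke n (Suc i mod n), rim n i}"

text \<open>For a fixed signature this predicate serves as the vector \<open>e\<close> of
  \<open>cost\<close>.\<close>

definition negative_triangle :: "nat \<Rightarrow> (nat set \<Rightarrow> int) \<Rightarrow> nat \<Rightarrow> bool" where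
  "negative_triangle n \<sigma> i \<longleftrightarrow> sign \<sigma> (triangle n i) = - 1"

lemma edges_wheel: "edges (wheel n) = rim n ` {..<n} \<union> spoke n ` {..<n}"
proof -
  have "edges (complete_graph {n}) = {}"
    by (auto simp: complete_graph_def card_2_iff)
  moreover have "edges (cycle_graph n) = rim n ` {..<n}"
  proof -
    have "{[0..<n] ! i, [0..<n] ! (Suc i mod n)} = rim n i" if "i < n" for i
    proof -
      have "Suc i mod n < n" using that by (intro mod_less_divisor) linarith
      with that show ?thesis by (simp add: rim_def)
    qed
    then show ?thesis
      unfolding cycle_graph_def cycle_edges_def by (simp add: setcompr_eq_image lessThan_def)
  qed
  moreover have "{{u, v} | u v. u \<in> verts (complete_graph {n}) \<and> v \<in> verts (cycle_graph n)} =
      spoke n ` {..<n}"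
    by (auto simp: complete_graph_def cycle_graph_def spoke_def)
  ultimately show ?thesis unfolding wheel_def join_def by simp
qed

lemma verts_wheel: "verts (wheel n) = {..n}"
  by (auto simp: wheel_def join_def complete_graph_def cycle_graph_def)

lemma spoke_eq_iff: "i < n \<Longrightarrow> j < n \<Longrightarrow> spoke n i = spoke n j \<longleftrightarrow> i = j"
  by (auto simp: spoke_def doubleton_eq_iff)

lemma rim_eq_iff: "3 \<le> n \<Longrightarrow> i < n \<Longrightarrow> j < n \<Longrightarrow> rim n i = rim n j \<longleftrightarrow> i = j"
  using inj_on_cycle_edge[of n] unfolding rim_def by (auto simp: inj_on_def)

lemma spoke_neq_rim: "i < n \<Longrightarrow> j < n \<Longrightarrow> spoke n i \<noteq> rim n j"
proof -
  assume "i < n" "j < n"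
  moreover have "Suc j mod n < n" using \<open>i < n\<close> by (intro mod_less_divisor) linarith
  ultimately have "n \<noteq> j" "n \<noteq> Suc j mod n" by linarith+
  then have "n \<in> spoke n i" "n \<notin> rim n j" by (simp_all add: spoke_def rim_def)
  then show ?thesis by metis
qed

lemma Suc_mod_neq: "3 \<le> n \<Longrightarrow> i < n \<Longrightarrow> Suc i mod n \<noteq> i"
  by (cases "Suc i = n") auto

lemma sign_triangle:
  assumes "3 \<le> n" "i < n"
  shows "sign \<sigma> (triangle n i) = \<sigma> (spoke n i) * \<sigma> (spoke n (Suc i mod n)) * \<sigma> (rim n i)"
proof -
  have "Suc i mod n < n" using assms by simp
  then show ?thesis
    using assms Suc_mod_neq[OF assms] spoke_eq_iff[of i n "Suc i mod n"] spoke_neq_rim[of i n i]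
      spoke_neq_rim[of "Suc i mod n" n i]
    by (simp add: sign_def triangle_def)
qed

lemma triangle_in_triangles:
  assumes "3 \<le> n" "i < n"
  shows "triangle n i \<in> triangles (wheel n)"
proof -
  let ?vs = "[n, i, Suc i mod n]"
  have lt: "Suc i mod n < n" using assms by simp
  have "cycle_edges ?vs = triangle n i"
  proof -
    have "cycle_edges ?vs = (\<lambda>k. {?vs ! k, ?vs ! (Suc k mod 3)}) ` {..<3}"
      by (auto simp: cycle_edges_def)
    also have "{..<3::nat} = {0, 1, 2}" by auto
    finally show ?thesis
      by (auto simp: triangle_def spoke_def rim_def insert_commute)
  qed
  moreover have "triangle n i \<subseteq> edges (wheel n)"
    using assms lt by (auto simp: edges_wheel triangle_def)
  moreover have "card (triangle n i) = 3"
    using assms lt Suc_mod_neq[OF assms] spoke_eq_iff[of i n "Suc i mod n"]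
      spoke_neq_rim[of i n i] spoke_neq_rim[of "Suc i mod n" n i]
    by (simp add: triangle_def)
  moreover have "distinct ?vs" "set ?vs \<subseteq> verts (wheel n)"
    using assms lt less_imp_neq[OF lt, symmetric] Suc_mod_neq[OF assms]
    by (auto simp: verts_wheel)
  ultimately show ?thesis
    unfolding triangles_def cycles_def by (auto intro!: exI[of _ ?vs])
qed

text \<open>A rim edge lies only in its own triangle; spoke \<open>j\<close> lies only in triangle
  \<open>j\<close> and in its cyclic predecessor, written
  \<open>(j + (n - 1)) mod n\<close>.\<close>

lemma card_triangles_of_edge:
  assumes "3 \<le> n" "f \<in> edges (wheel n)"
  shows "card {i. i < n \<and> f \<in> triangle n i} \<le> 2"
proof -
  have lt: "Suc i mod n < n" if "i < n" for i using that by simp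
  consider j where "j < n" "f = spoke n j" | j where "j < n" "f = rim n j"
    using assms(2) by (auto simp: edges_wheel)
  then obtain a b where "{i. i < n \<and> f \<in> triangle n i} \<subseteq> {a, b}"
  proof cases
    case (1 j)
    have "i = j \<or> i = (j + (n - 1)) mod n" if "i < n" "f \<in> triangle n i" for i
    proof -
      have "i = j \<or> Suc i mod n = j"
        using that 1 lt by (auto simp: triangle_def spoke_eq_iff spoke_neq_rim)
      moreover have "(Suc i mod n + (n - 1)) mod n = i"
        using mod_rotate_back(1)[of 1 n i] that by simp
      ultimately show ?thesis by metis
    qed
    with that show ?thesis by blast
  next
    case (2 j)
    have "i = j" if "i < n" "f \<in> triangle n i" for i
      using that 2 assms(1) lt spoke_neq_rim[of _ n j, symmetric]
      by (auto simp: triangle_def rim_eq_iff)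
    with that[of j j] show ?thesis by blast
  qed
  from card_mono[OF _ this] card_insert_le_m1[of 2 "{b}" a] show ?thesis by simp
qed

section \<open>Lower and upper bounds for the frustration index\<close>

lemma frustration_index_wheel_ge:
  assumes "3 \<le> n" "\<And>i. i < n \<Longrightarrow> negative_triangle n \<sigma> i"
  shows "n \<le> 2 * frustration_index (wheel n) \<sigma>"
proof -
  obtain F where F: "F \<subseteq> edges (wheel n)"
    "balanced (delete_edges (wheel n) F) (restrict \<sigma> (edges (wheel n) - F))"
    "frustration_index (wheel n) \<sigma> = card F"
    using frustration_index_attained[OF simple_graph_wheel[OF assms(1)]] by metis
  have "finite F" using F(1) finite_edges[OF simple_graph_wheel[OF assms(1)]] finite_subset by blast
  \<comment> \<open>Double counting: \<open>F\<close> meets all \<open>n\<close> negative triangles,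
    while each of its edges accounts for at most two.\<close>
  have "{..<n} \<subseteq> (\<Union>f\<in>F. {i. i < n \<and> f \<in> triangle n i})"
  proof
    fix i assume i: "i \<in> {..<n}"
    then have "triangle n i \<inter> F \<noteq> {}"
      using triangle_in_triangles[OF assms(1)] assms(2) F(2)
      by (intro negative_cycle_hit) (auto simp: negative_triangle_def triangles_def)
    with i show "i \<in> (\<Union>f\<in>F. {i. i < n \<and> f \<in> triangle n i})" by blast
  qed
  from card_mono[OF _ this] have "n \<le> card (\<Union>f\<in>F. {i. i < n \<and> f \<in> triangle n i})"
    using \<open>finite F\<close> by simp
  also have "\<dots> \<le> (\<Sum>f\<in>F. card {i. i < n \<and> f \<in> triangle n i})"
    using \<open>finite F\<close> by (rule card_UN_le)
  also have "\<dots> \<le> (\<Sum>f\<in>F. 2)"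
    using F(1) card_triangles_of_edge[OF assms(1)] by (intro sum_mono) auto
  finally show ?thesis by (simp add: F(3))
qed

text \<open>A balancing set contains an edge of every negative cycle, and disjoint cycles receive
  different edges.\<close>

lemma frustration_index_ge_disjoint_negative_cycles:
  assumes "simple_graph G" "T \<subseteq> cycles G" "pairwise disjnt T" "\<And>C. C \<in> T \<Longrightarrow> sign \<sigma> C \<noteq> 1"
  shows "card T \<le> frustration_index G \<sigma>"
proof -
  obtain F where F: "F \<subseteq> edges G" "balanced (delete_edges G F) (restrict \<sigma> (edges G - F))"
    "frustration_index G \<sigma> = card F"
    using frustration_index_attained[OF assms(1)] by metis
  have "finite F" using F(1) finite_edges[OF assms(1)] finite_subset by blast
  have "\<exists>f. f \<in> C \<inter> F" if "C \<in> T" for C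
  proof -
    have "C \<inter> F \<noteq> {}" using negative_cycle_hit[OF _ assms(4)[OF that] F(2)] assms(2) that by blast
    then show ?thesis by blast
  qed
  then have "\<forall>C\<in>T. \<exists>f. f \<in> C \<inter> F" by blast
  from bchoice[OF this] obtain h where h: "\<And>C. C \<in> T \<Longrightarrow> h C \<in> C \<inter> F" by blast
  have "inj_on h T"
  proof (rule inj_onI, rule ccontr)
    fix C D assume "C \<in> T" "D \<in> T" "h C = h D" "C \<noteq> D"
    then have "disjnt C D" using assms(3) by (simp add: pairwise_def)
    moreover have "h C \<in> C" "h C \<in> D" using h[OF \<open>C \<in> T\<close>] h[OF \<open>D \<in> T\<close>] \<open>h C = h D\<close> by simp_all
    ultimately show False by (auto simp: disjnt_iff)
  qed
  moreover have "h ` T \<subseteq> F" using h by blast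
  ultimately show ?thesis using card_inj_on_le \<open>finite F\<close> F(3) by metis
qed

text \<open>Switching the spoke at \<open>i\<close> positive turns the rim edge \<open>i\<close> into the sign of the triangle \<open>i\<close>;
  switching further at \<open>{i. x i}\<close> makes the negative edges those counted by \<open>cost\<close>.\<close>

lemma frustration_index_le_cost:
  assumes "3 \<le> n" "\<sigma> \<in> signatures (wheel n)"
  shows "frustration_index (wheel n) \<sigma> \<le> cost n (negative_triangle n \<sigma>) x"
proof -
  let ?e = "negative_triangle n \<sigma>"
  let ?F = "spoke n ` {i. i < n \<and> x i} \<union> rim n ` mismatches n ?e x"
  \<comment> \<open>The potential that the surviving edges must satisfy: hub 1, and each rim vertex
    the sign of its spoke, reversed where \<open>x\<close> holds.\<close>
  define s where "s v = (if v = n then 1 else \<sigma> (spoke n v) * (if x v then - 1 else 1))" for v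
  have unit: "\<sigma> f = 1 \<or> \<sigma> f = - 1" if "f \<in> edges (wheel n)" for f
    using assms(2) that by (auto simp: signatures_def PiE_iff)
  have spoke_unit: "\<sigma> (spoke n i) = 1 \<or> \<sigma> (spoke n i) = - 1"
    and rim_unit: "\<sigma> (rim n i) = 1 \<or> \<sigma> (rim n i) = - 1" if "i < n" for i
    using that by (auto intro!: unit simp: edges_wheel)
  have spoke_edge: "\<sigma> (spoke n i) = s n * s i" if "i < n" "spoke n i \<notin> ?F" for i
  proof -
    from that have "\<not> x i" by auto
    with that show ?thesis by (simp add: s_def)
  qed
  \<comment> \<open>The triangle sign expresses the rim sign through the two spokes; the factors
    coming from \<open>x\<close> agree with it exactly when \<open>i\<close> is no mismatch.\<close>
  have rim_edge: "\<sigma> (rim n i) = s i * s (Suc i mod n)" if "i < n" "rim n i \<notin> ?F" for i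
  proof -
    have lt: "Suc i mod n < n" using that by simp
    from that have "(x i \<noteq> x (Suc i mod n)) = ?e i" by (auto simp: mismatches_def)
    moreover have "s i = \<sigma> (spoke n i) * (if x i then - 1 else 1)"
      using that(1) by (simp add: s_def)
    moreover have "s (Suc i mod n) = \<sigma> (spoke n (Suc i mod n)) * (if x (Suc i mod n) then - 1 else 1)"
      using less_imp_neq[OF lt] by (simp only: s_def if_False)
    ultimately show ?thesis
      unfolding negative_triangle_def sign_triangle[OF assms(1) that(1)]
      using spoke_unit[OF lt] spoke_unit[OF that(1)] rim_unit[OF that(1)]
      by (elim disjE) (simp_all split: if_splits)
  qed
  have "balanced (delete_edges (wheel n) ?F) (restrict \<sigma> (edges (wheel n) - ?F))"
  proof (rule balanced_if_potential[where s = s])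
    fix u v assume uv: "{u, v} \<in> edges (delete_edges (wheel n) ?F)"
    then have "{u, v} \<in> edges (wheel n)" "{u, v} \<notin> ?F" by (auto simp: delete_edges_def)
    moreover have "\<sigma> {u, v} = s u * s v"
    proof -
      consider i where "i < n" "{u, v} = spoke n i" | i where "i < n" "{u, v} = rim n i"
        using \<open>{u, v} \<in> edges (wheel n)\<close> by (auto simp: edges_wheel)
      then show ?thesis
      proof cases
        case (1 i)
        then have "\<sigma> {u, v} = s n * s i" using spoke_edge[of i] \<open>{u, v} \<notin> ?F\<close> by metis
        moreover have "u = n \<and> v = i \<or> u = i \<and> v = n"
          using 1(2) by (simp add: spoke_def doubleton_eq_iff)
        ultimately show ?thesis by (metis mult.commute)
      next
        case (2 i)
        then have "\<sigma> {u, v} = s i * s (Suc i mod n)"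
          using rim_edge[of i] \<open>{u, v} \<notin> ?F\<close> by metis
        moreover have "u = i \<and> v = Suc i mod n \<or> u = Suc i mod n \<and> v = i"
          using 2(2) by (simp add: rim_def doubleton_eq_iff)
        ultimately show ?thesis by (metis mult.commute)
      qed
    qed
    ultimately show "restrict \<sigma> (edges (wheel n) - ?F) {u, v} = s u * s v" by simp
  next
    fix v assume "v \<in> verts (delete_edges (wheel n) ?F)"
    then have "v \<le> n" by (simp add: delete_edges_def verts_wheel)
    with spoke_unit[of v] show "s v * s v = 1" by (auto simp: s_def)
  qed
  moreover have "?F \<subseteq> edges (wheel n)" by (auto simp: edges_wheel mismatches_def)
  ultimately have "frustration_index (wheel n) \<sigma> \<le> card ?F"
    using frustration_index_le[OF simple_graph_wheel[OF assms(1)]] by blast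
  also have "\<dots> \<le> card {i. i < n \<and> x i} + card (mismatches n ?e x)"
    by (intro order_trans[OF card_Un_le] add_mono card_image_le) (auto simp: mismatches_def)
  also have "card {i. i < n \<and> x i} = ones n x"
  proof -
    have "{i. i < n \<and> x i} = {..<n} \<inter> {i. x i}" by auto
    then show ?thesis by (simp add: ones_def)
  qed
  finally show ?thesis by (simp add: cost_def)
qed

section \<open>The maximum over all signatures\<close>

lemma finite_signatures: "simple_graph G \<Longrightarrow> finite (signatures G)"
  unfolding signatures_def by (intro finite_PiE finite_edges) auto

lemma all_negative_in_signatures: "all_negative G \<in> signatures G"
  by (auto simp: all_negative_def signatures_def)

lemma negative_triangle_all_negative:
  assumes "3 \<le> n" "i < n"
  shows "negative_triangle n (all_negative (wheel n)) i"
  using assms by (simp add: negative_triangle_def sign_triangle all_negative_def edges_wheel)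

lemma frustration_index_wheel_le:
  assumes "3 \<le> n" "\<sigma> \<in> signatures (wheel n)"
  shows "frustration_index (wheel n) \<sigma> \<le> (n + 1) div 2"
  using frustration_index_le_cost[OF assms] exists_cost_le_upper_half[OF assms(1)] order_trans
  by metis

lemma frustration_index_wheel_all_triangles_negative:
  assumes "3 \<le> n" "\<sigma> \<in> signatures (wheel n)" "\<And>i. i < n \<Longrightarrow> negative_triangle n \<sigma> i"
  shows "frustration_index (wheel n) \<sigma> = (n + 1) div 2"
proof (rule antisym)
  show "(n + 1) div 2 \<le> frustration_index (wheel n) \<sigma>"
    using frustration_index_wheel_ge[OF assms(1,3)] by fastforce
qed (rule frustration_index_wheel_le[OF assms(1,2)])

lemma frustration_index_all_negative_wheel:
  assumes "3 \<le> n"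
  shows "frustration_index (wheel n) (all_negative (wheel n)) = (n + 1) div 2"
  using assms
  by (intro frustration_index_wheel_all_triangles_negative all_negative_in_signatures
      negative_triangle_all_negative)

lemma max_frustration_index_wheel:
  assumes "3 \<le> n"
  shows "max_frustration_index (wheel n) = (n + 1) div 2"
  unfolding max_frustration_index_def
proof (rule Max_eqI)
  show "finite (frustration_index (wheel n) ` signatures (wheel n))"
    using assms by (intro finite_imageI finite_signatures simple_graph_wheel)
  show "y \<le> (n + 1) div 2" if "y \<in> frustration_index (wheel n) ` signatures (wheel n)" for y
    using that frustration_index_wheel_le[OF assms] by blast
  show "(n + 1) div 2 \<in> frustration_index (wheel n) ` signatures (wheel n)"
    using frustration_index_all_negative_wheel[OF assms] all_negative_in_signatures
    by (metis imageI)
qed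

section \<open>Odd wheels: uniqueness of the maximising switching class\<close>

lemma frustration_index_odd_wheel_maximal_iff:
  assumes "3 \<le> n" "odd n" "\<sigma> \<in> signatures (wheel n)"
  shows "frustration_index (wheel n) \<sigma> = (n + 1) div 2 \<longleftrightarrow> (\<forall>i<n. negative_triangle n \<sigma> i)"
proof
  assume max: "frustration_index (wheel n) \<sigma> = (n + 1) div 2"
  show "\<forall>i<n. negative_triangle n \<sigma> i"
  proof (rule ccontr)
    assume "\<not> (\<forall>i<n. negative_triangle n \<sigma> i)"
    \<comment> \<open>For odd \<open>n\<close>, \<open>n div 2\<close> is strictly below the
      maximum, so a single positive triangle already excludes maximality.\<close>
    then obtain x where "cost n (negative_triangle n \<sigma>) x \<le> n div 2"
      using exists_cost_le_half[OF assms(1)] by blast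
    with frustration_index_le_cost[OF assms(1,3), of x] max assms(2) show False
      by (auto elim!: oddE)
  qed
qed (use frustration_index_wheel_all_triangles_negative assms in blast)

text \<open>Switching preserves triangle signs. Conversely, switching can give the spokes any signs,
  and the triangle signs then determine the rim.\<close>

lemma switch_class_all_negative_wheel:
  assumes "3 \<le> n"
  shows "switching_rel (wheel n) `` {all_negative (wheel n)} =
    {\<sigma> \<in> signatures (wheel n). \<forall>i<n. negative_triangle n \<sigma> i}"
proof (intro set_eqI iffI)
  let ?A = "all_negative (wheel n)"
  have lt: "Suc i mod n < n" if "i < n" for i using that by simp
  have on_spoke: "switch (wheel n) X ?A (spoke n i) = (if (n \<in> X) \<noteq> (i \<in> X) then 1 else - 1)"
    and on_rim: "switch (wheel n) X ?A (rim n i) = (if (i \<in> X) \<noteq> (Suc i mod n \<in> X) then 1 else - 1)"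
    if "i < n" for i X
    using that card_edge_Int_eq_1[of n i X] card_edge_Int_eq_1[of i "Suc i mod n" X]
      Suc_mod_neq[OF assms that]
    by (auto simp: switch_def all_negative_def edges_wheel spoke_def rim_def)
  fix \<sigma>
  {
    assume "\<sigma> \<in> switching_rel (wheel n) `` {?A}"
    then obtain X where X: "\<sigma> = switch (wheel n) X ?A" by (auto simp: switching_rel_def)
    have "negative_triangle n \<sigma> i" if "i < n" for i
      unfolding negative_triangle_def sign_triangle[OF assms that] X
      using on_spoke[OF that] on_spoke[OF lt[OF that]] on_rim[OF that] by auto
    moreover have "\<sigma> \<in> signatures (wheel n)"
      unfolding X by (intro switch_in_signatures all_negative_in_signatures)
    ultimately show "\<sigma> \<in> {\<sigma> \<in> signatures (wheel n). \<forall>i<n. negative_triangle n \<sigma> i}" by blast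
  }
  {
    assume "\<sigma> \<in> {\<sigma> \<in> signatures (wheel n). \<forall>i<n. negative_triangle n \<sigma> i}"
    then have sig: "\<sigma> \<in> signatures (wheel n)" and neg: "\<And>i. i < n \<Longrightarrow> negative_triangle n \<sigma> i"
      by auto
    have unit: "\<sigma> f = 1 \<or> \<sigma> f = - 1" if "f \<in> edges (wheel n)" for f
      using sig that by (auto simp: signatures_def PiE_iff)
    \<comment> \<open>Starting from all edges negative, switching at these rim vertices makes
      exactly the required spokes positive.\<close>
    define X where "X = {i. i < n \<and> \<sigma> (spoke n i) = 1}"
    have on_edges: "\<sigma> f = switch (wheel n) X ?A f" if f: "f \<in> edges (wheel n)" for f
    proof -
      have spk: "\<sigma> (spoke n i) = switch (wheel n) X ?A (spoke n i)" if "i < n" for i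
        using that unit[of "spoke n i"] on_spoke[OF that, of X] by (auto simp: X_def edges_wheel)
      have "\<sigma> (rim n i) = switch (wheel n) X ?A (rim n i)" if i: "i < n" for i
      proof -
        have "\<sigma> (spoke n i) * \<sigma> (spoke n (Suc i mod n)) * \<sigma> (rim n i) = - 1"
          using neg[OF i] by (simp add: negative_triangle_def sign_triangle[OF assms i])
        moreover have "\<sigma> (rim n i) = 1 \<or> \<sigma> (rim n i) = - 1"
          using i by (intro unit) (auto simp: edges_wheel)
        moreover have "n \<notin> X" by (simp add: X_def)
        ultimately show ?thesis
          using spk[OF i] spk[OF lt[OF i]] on_spoke[OF i, of X] on_spoke[OF lt[OF i], of X]
            on_rim[OF i, of X]
          by (auto split: if_splits)
      qed
      with spk f show ?thesis by (auto simp: edges_wheel)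
    qed
    have "\<sigma> f = switch (wheel n) X ?A f" for f
    proof (cases "f \<in> edges (wheel n)")
      case False
      with sig show ?thesis by (auto simp: switch_def signatures_def PiE_iff extensional_def)
    qed (rule on_edges)
    then have "\<sigma> = switch (wheel n) X ?A" by blast
    moreover have "X \<subseteq> verts (wheel n)" by (auto simp: X_def verts_wheel)
    ultimately show "\<sigma> \<in> switching_rel (wheel n) `` {?A}"
      using all_negative_in_signatures[of "wheel n"] by (auto simp: switching_rel_def)
  }
qed

text \<open>The class of the all-negative signature is the set of all maximisers. Any maximising
  class therefore meets it, and classes that meet coincide.\<close>

lemma maximising_class_odd_wheel_iff:
  assumes "3 \<le> n" "odd n"
  shows "maximising_class (wheel n) K \<longleftrightarrow> K = switching_rel (wheel n) `` {all_negative (wheel n)}"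
    (is "_ \<longleftrightarrow> K = ?K")
proof
  have K: "?K = {\<sigma> \<in> signatures (wheel n). frustration_index (wheel n) \<sigma> = (n + 1) div 2}"
    unfolding switch_class_all_negative_wheel[OF assms(1)]
    using frustration_index_odd_wheel_maximal_iff[OF assms] by blast
  have eq: "equiv (signatures (wheel n)) (switching_rel (wheel n))"
    using assms(1) by (intro equiv_switching_rel simple_graph_wheel)
  have cls: "?K \<in> switching_classes (wheel n)"
    unfolding switching_classes_def by (intro quotientI all_negative_in_signatures)
  {
    assume "maximising_class (wheel n) K"
    then have max: "K \<in> switching_classes (wheel n)"
      "frustration_index (wheel n) ` K = {(n + 1) div 2}"
      by (auto simp: maximising_class_def max_frustration_index_wheel[OF assms(1)])
    then obtain \<sigma> where \<sigma>: "\<sigma> \<in> K" "frustration_index (wheel n) \<sigma> = (n + 1) div 2" by blast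
    moreover have "\<sigma> \<in> signatures (wheel n)"
      using \<sigma>(1) max(1) in_quotient_imp_subset[OF eq] unfolding switching_classes_def by blast
    ultimately have "\<sigma> \<in> K \<inter> ?K" unfolding K by blast
    with quotient_disj[OF eq] max(1) cls show "K = ?K" unfolding switching_classes_def by blast
  }
  {
    assume "K = ?K"
    moreover have "all_negative (wheel n) \<in> ?K"
      using all_negative_in_signatures frustration_index_all_negative_wheel[OF assms(1)]
      unfolding K by blast
    ultimately show "maximising_class (wheel n) K"
      using cls K by (auto simp: maximising_class_def max_frustration_index_wheel[OF assms(1)])
  }
qed

section \<open>Even wheels: maximisers and disjoint negative triangles\<close>

lemma disjnt_triangles:
  assumes "4 \<le> n" "even n" "i < n" "j < n" "i \<noteq> j" "even i = even j"
  shows "disjnt (triangle n i) (triangle n j)"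
proof -
  \<comment> \<open>Parity alternates around the rim, even across the wrap at \<open>n\<close>, so
    triangles of equal parity are never consecutive.\<close>
  have par: "even (Suc k mod n) \<noteq> even k" if "k < n" for k
    using that assms(2) by (cases "Suc k = n") auto
  have "Suc i mod n \<noteq> j" "Suc j mod n \<noteq> i"
    using par[OF assms(3)] par[OF assms(4)] assms(6) by auto
  moreover have "Suc i mod n \<noteq> Suc j mod n"
    using mod_rotate_back(1)[of 1 n i] mod_rotate_back(1)[of 1 n j] assms by force
  moreover have "Suc i mod n < n" "Suc j mod n < n" using assms by auto
  ultimately show ?thesis
    using assms by (auto simp: disjnt_def triangle_def spoke_eq_iff rim_eq_iff spoke_neq_rim
        spoke_neq_rim[symmetric])
qed

lemma frustration_index_even_wheel_maximal_iff:
  assumes "3 \<le> n" "even n" "\<sigma> \<in> signatures (wheel n)"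
  shows "frustration_index (wheel n) \<sigma> = n div 2 \<longleftrightarrow>
    (\<exists>T. T \<subseteq> triangles (wheel n) \<and> card T = n div 2 \<and> pairwise disjnt T \<and>
       (\<forall>C\<in>T. sign \<sigma> C = - 1))"
proof
  have n4: "4 \<le> n" using assms(1,2) by (cases "n = 3") auto
  assume max: "frustration_index (wheel n) \<sigma> = n div 2"
  \<comment> \<open>Positive triangles of both parities would push the cost below
    \<open>n div 2\<close>; so some parity class, with offset \<open>r\<close>, is entirely negative
    and supplies the triangles.\<close>
  have "\<exists>r\<le>1. \<forall>i<n div 2. negative_triangle n \<sigma> (2 * i + r)"
  proof (rule ccontr)
    assume no: "\<not> ?thesis"
    from no have "\<not> (\<forall>i<n div 2. negative_triangle n \<sigma> (2 * i + 0))"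
        "\<not> (\<forall>i<n div 2. negative_triangle n \<sigma> (2 * i + 1))"
      using zero_le_one order_refl by metis+
    then obtain i j where ij: "i < n div 2" "\<not> negative_triangle n \<sigma> (2 * i)"
        "j < n div 2" "\<not> negative_triangle n \<sigma> (2 * j + 1)"
      by auto
    from ij(1,3) assms(2) have "2 * i < n" "2 * j + 1 < n" by presburger+
    from exists_cost_less_half[OF n4 assms(2) this ij(2,4)]
    obtain x where "cost n (negative_triangle n \<sigma>) x < n div 2" by auto
    with frustration_index_le_cost[OF assms(1,3), of x] max show False by linarith
  qed
  then obtain r where r: "r \<le> 1" "\<And>i. i < n div 2 \<Longrightarrow> negative_triangle n \<sigma> (2 * i + r)"
    by blast
  define T where "T = (\<lambda>i. triangle n (2 * i + r)) ` {..<n div 2}"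
  have lt: "2 * i + r < n" if "i < n div 2" for i using that r(1) assms(2) by presburger
  have disj: "disjnt (triangle n (2 * i + r)) (triangle n (2 * j + r))"
    if "i < n div 2" "j < n div 2" "i \<noteq> j" for i j
    using that lt[of i] lt[of j] by (intro disjnt_triangles n4 assms(2)) simp_all
  have "inj_on (\<lambda>i. triangle n (2 * i + r)) {..<n div 2}"
  proof (rule inj_onI, rule ccontr)
    fix i j assume "i \<in> {..<n div 2}" "j \<in> {..<n div 2}" "i \<noteq> j"
      "triangle n (2 * i + r) = triangle n (2 * j + r)"
    with disj[of i j] have "triangle n (2 * j + r) = {}" by simp
    then show False by (simp add: triangle_def)
  qed
  then have "card T = n div 2" by (simp add: T_def card_image)
  moreover have "T \<subseteq> triangles (wheel n)"
    using triangle_in_triangles[OF assms(1)] lt by (auto simp: T_def)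
  moreover have "pairwise disjnt T"
    unfolding T_def pairwise_def using disj by force
  moreover have "\<forall>C\<in>T. sign \<sigma> C = - 1"
    using r(2) by (auto simp: T_def negative_triangle_def)
  ultimately show "\<exists>T. T \<subseteq> triangles (wheel n) \<and> card T = n div 2 \<and> pairwise disjnt T \<and>
       (\<forall>C\<in>T. sign \<sigma> C = - 1)" by blast
next
  assume "\<exists>T. T \<subseteq> triangles (wheel n) \<and> card T = n div 2 \<and> pairwise disjnt T \<and>
       (\<forall>C\<in>T. sign \<sigma> C = - 1)"
  then obtain T where T: "T \<subseteq> triangles (wheel n)" "card T = n div 2" "pairwise disjnt T"
    "\<forall>C\<in>T. sign \<sigma> C = - 1" by blast
  have "card T \<le> frustration_index (wheel n) \<sigma>"
    using T by (intro frustration_index_ge_disjoint_negative_cycles simple_graph_wheel assms(1))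
      (auto simp: triangles_def)
  \<comment> \<open>For even \<open>n\<close> the upper bound \<open>(n + 1) div 2\<close> equals
    \<open>n div 2\<close>, matching the lower bound from \<open>T\<close>.\<close>
  with T(2) frustration_index_wheel_le[OF assms(1,3)] assms(2)
  show "frustration_index (wheel n) \<sigma> = n div 2" by simp
qed

theorem corollary25:
  fixes n :: nat
  assumes "n \<ge> 3"
  shows "max_frustration_index (wheel n) = frustration_index (wheel n) (all_negative (wheel n)) \<and>
    int (frustration_index (wheel n) (all_negative (wheel n))) = \<lceil>real n / 2\<rceil> \<and>
    (odd n \<longrightarrow>
      (\<forall>K. maximising_class (wheel n) K \<longleftrightarrow>
           K = switching_rel (wheel n) `` {all_negative (wheel n)})) \<and>
    (even n \<longrightarrow>
      (\<forall>\<sigma>\<in>signatures (wheel n).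
         frustration_index (wheel n) \<sigma> = max_frustration_index (wheel n) \<longleftrightarrow>
         (\<exists>T. T \<subseteq> triangles (wheel n) \<and> card T = n div 2 \<and> pairwise disjnt T \<and>
              (\<forall>C\<in>T. sign \<sigma> C = - 1))))"
proof (intro conjI impI allI ballI)
  show "max_frustration_index (wheel n) = frustration_index (wheel n) (all_negative (wheel n))"
    using assms by (simp add: max_frustration_index_wheel frustration_index_all_negative_wheel)
  have "int ((n + 1) div 2) = \<lceil>real n / 2\<rceil>"
    by (rule ceiling_unique[symmetric]) (cases "even n"; auto elim!: evenE oddE)+
  then show "int (frustration_index (wheel n) (all_negative (wheel n))) = \<lceil>real n / 2\<rceil>"
    by (simp only: frustration_index_all_negative_wheel[OF assms])
  show "maximising_class (wheel n) K \<longleftrightarrow> K = switching_rel (wheel n) `` {all_negative (wheel n)}"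
    if "odd n" for K
    using assms that by (rule maximising_class_odd_wheel_iff)
  show "frustration_index (wheel n) \<sigma> = max_frustration_index (wheel n) \<longleftrightarrow>
      (\<exists>T. T \<subseteq> triangles (wheel n) \<and> card T = n div 2 \<and> pairwise disjnt T \<and>
         (\<forall>C\<in>T. sign \<sigma> C = - 1))"
    if "even n" "\<sigma> \<in> signatures (wheel n)" for \<sigma>
    using frustration_index_even_wheel_maximal_iff[OF assms that] that(1)
    by (simp add: max_frustration_index_wheel[OF assms])
qed

end
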